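(* Let $f(\lambda):=\sum_{k=0}^\infty\alpha_k\lambda^k$ be a power series with complex coefficients, convergent on the open disk $D(0,R)$, $R>0$, and let $f_a(\lambda):=\sum_{k=0}^\infty|\alpha_k|\lambda^k$. If $A$ and $B$ are positive semidefinite matrices in $M_n(\mathbb{C})$ with $\operatorname{tr}(A^2)<R$ and $\operatorname{tr}(B^2)<R$, then $$\left|\operatorname{tr}[f(AB)]\right|^2\le\operatorname{tr}\left[f_a(A^2)\right]\operatorname{tr}\left[f_a(B^2)\right].$$ If $\operatorname{tr}(A)<\sqrt{R}$ and $\operatorname{tr}(B)<\sqrt{R}$, then also $$\left|\operatorname{tr}[f(AB)]\right|\le\min\left\{\operatorname{tr}\left(f_a(\|A\|B)\right),\operatorname{tr}\left(f_a(\|B\|A)\right)\right\}.$$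
   Context: $D(0,R)=\{z\in\mathbb{C}:|z|<R\}$ if $R<\infty$ and $D(0,\infty)=\mathbb{C}$ (with $\sqrt{R}=\infty$ in that case). $M_n(\mathbb{C})$ is the algebra of complex $n\times n$ matrices, $\|\cdot\|$ is the operator norm, and $f(T):=\sum_{k=0}^\infty\alpha_kT^k$ with $T^0=I_n$; similarly for $f_a$. *)

theory Defs
  imports "HOL-Analysis.Analysis"
begin

definition conj_transpose :: "complex^'n^'m \<Rightarrow> complex^'m^'n" where
  "conj_transpose A = (\<chi> i j. cnj (A $ j $ i))"

definition pos_semidef :: "complex^'n^'n \<Rightarrow> bool" where
  "pos_semidef A \<longleftrightarrow> conj_transpose A = A \<and>
     (\<forall>x. 0 \<le> Re (\<Sum>i\<in>UNIV. cnj (x $ i) * (A *v x) $ i))"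

text \<open>The norm on \<^typ>\<open>complex^'n\<close> is Euclidean, so this is the spectral norm.\<close>

definition op_norm :: "complex^'n^'n \<Rightarrow> real" where
  "op_norm A = onorm ((*v) A)"

text \<open>Powers for the matrix product; the library operations \<open>*\<close> and \<open>^\<close>
  on \<^typ>\<open>complex^'n^'n\<close> act entrywise.\<close>

primrec mat_pow :: "complex^'n^'n \<Rightarrow> nat \<Rightarrow> complex^'n^'n" where
  "mat_pow T 0 = mat 1"
| "mat_pow T (Suc k) = T ** mat_pow T k"

text \<open>Multiplication by the scalar matrix \<^term>\<open>mat (\<alpha> k)\<close> is multiplication by the
  scalar \<^term>\<open>\<alpha> k\<close>.\<close>

definition mat_power_series :: "(nat \<Rightarrow> complex) \<Rightarrow> complex^'n^'n \<Rightarrow> complex^'n^'n" where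
  "mat_power_series \<alpha> T = (\<Sum>k. mat (\<alpha> k) ** mat_pow T k)"

definition abs_coeffs :: "(nat \<Rightarrow> complex) \<Rightarrow> nat \<Rightarrow> complex" where
  "abs_coeffs \<alpha> k = complex_of_real (cmod (\<alpha> k))"

text \<open>Only used for positive arguments.\<close>

definition ereal_sqrt :: "ereal \<Rightarrow> ereal" where
  "ereal_sqrt R = (if R = \<infinity> then \<infinity> else ereal (sqrt (real_of_ereal R)))"

text \<open>The traces of positive semidefinite matrices, and of the power series with nonnegative
  coefficients in such matrices, are real; their real part is taken in order to compare them.\<close>

definition re_trace :: "complex^'n^'n \<Rightarrow> real" where
  "re_trace A = Re (trace A)"

end

theory Submission
  imports Defs
begin

text \<open>Both estimates are proved coefficient by coefficient. For Hermitian \<open>A\<close>, \<open>B\<close> the bound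
  \<open>\<bar>tr ((A B)\<^sup>k)\<bar>\<^sup>2 \<le> tr (A\<^sup>2\<^sup>k) tr (B\<^sup>2\<^sup>k)\<close> is a chessboard estimate: the Cauchy-Schwarz inequality
  for the Hilbert-Schmidt inner product, applied to a word in \<open>A\<close> and \<open>B\<close> cut in two halves,
  replaces the word by the two palindromes built from the halves. The Cauchy-Schwarz
  inequality for series then gives the first claim. For positive semidefinite \<open>A\<close>, \<open>B\<close> the function
  \<open>A \<mapsto> tr ((A B)\<^sup>k)\<close> is monotone, as its derivative in a positive semidefinite direction is
  nonnegative; replacing \<open>A\<close> by \<open>\<parallel>A\<parallel> I\<close> gives the second claim. Convergence is controlled by
  the Frobenius norm, which is the library norm on \<^typ>\<open>complex^'n^'n\<close>, is submultiplicative,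
  and is at most the trace on positive semidefinite matrices.\<close>

section \<open>Positive semidefinite matrices\<close>

lemma conj_transpose_nth [simp]: "conj_transpose A $ i $ j = cnj (A $ j $ i)"
  by (simp add: conj_transpose_def)

lemma conj_transpose_conj_transpose [simp]: "conj_transpose (conj_transpose A) = A"
  by (simp add: vec_eq_iff)

lemma conj_transpose_mult:
  "conj_transpose (A ** B) = conj_transpose B ** conj_transpose A"
  by (simp add: vec_eq_iff matrix_matrix_mult_def mult.commute)

lemma conj_transpose_add: "conj_transpose (A + B) = conj_transpose A + conj_transpose B"
  by (simp add: vec_eq_iff)

lemma conj_transpose_diff: "conj_transpose (A - B) = conj_transpose A - conj_transpose B"
  by (simp add: vec_eq_iff)

lemma conj_transpose_scaleR: "conj_transpose (c *\<^sub>R A) = c *\<^sub>R conj_transpose A"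
  by (simp add: vec_eq_iff)

lemma conj_transpose_mat_1 [simp]: "conj_transpose (mat 1) = mat 1"
  by (simp add: vec_eq_iff mat_def)

lemma trace_conj_transpose: "trace (conj_transpose A) = cnj (trace A)"
  by (simp add: trace_def)

lemma trace_scaleR: "trace (c *\<^sub>R A) = c *\<^sub>R trace (A :: complex^'n^'n)"
  by (simp add: trace_def scaleR_sum_right)

lemma bounded_bilinear_matrix_mult:
  "bounded_bilinear ((**) :: complex^'n^'m \<Rightarrow> complex^'p^'n \<Rightarrow> complex^'p^'m)"
  unfolding bilinear_conv_bounded_bilinear[symmetric]
  by (auto simp: bilinear_def linear_iff vec_eq_iff matrix_matrix_mult_def sum.distrib
      scaleR_sum_right algebra_simps)

lemma bounded_linear_trace: "bounded_linear (trace :: complex^'n^'n \<Rightarrow> complex)"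
  unfolding linear_conv_bounded_linear[symmetric]
  by (simp add: linear_iff trace_scaleR trace_add)

lemma bounded_linear_matrix_vector: "bounded_linear ((*v) (A :: complex^'n^'m))"
  unfolding linear_conv_bounded_linear[symmetric]
  by (auto simp: linear_iff vec_eq_iff matrix_vector_mult_def sum.distrib
      scaleR_sum_right algebra_simps)

text \<open>Here \<open>\<bullet>\<close> is the real part of the Hermitian inner product, and
  taking real parts preserves the adjoint relation.\<close>

lemma inner_conj_transpose:
  "x \<bullet> (A *v y) = (conj_transpose A *v x) \<bullet> y"
proof -
  have "x \<bullet> (A *v y) = (\<Sum>i\<in>UNIV. \<Sum>j\<in>UNIV. Re (cnj (x $ i) * (A $ i $ j * y $ j)))"
    by (simp add: inner_vec_def inner_complex_def matrix_vector_mult_def sum_distrib_left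
        flip: sum.distrib)
  also have "\<dots> = (\<Sum>j\<in>UNIV. \<Sum>i\<in>UNIV. Re (cnj (x $ i) * (A $ i $ j * y $ j)))"
    by (rule sum.swap)
  also have "\<dots> = (conj_transpose A *v x) \<bullet> y"
    by (simp add: inner_vec_def inner_complex_def matrix_vector_mult_def sum_distrib_right
        sum_distrib_left algebra_simps flip: sum.distrib sum_subtractf)
  finally show ?thesis .
qed

section \<open>Positive semidefiniteness through the real quadratic form\<close>

lemma pos_semidef_iff:
  "pos_semidef A \<longleftrightarrow> conj_transpose A = A \<and> (\<forall>x. 0 \<le> x \<bullet> (A *v x))"
  by (simp add: pos_semidef_def inner_vec_def inner_complex_def)

lemma pos_semidefD:
  assumes "pos_semidef A"
  shows "conj_transpose A = A" "0 \<le> x \<bullet> (A *v x)"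
  using assms by (auto simp: pos_semidef_iff)

lemma pos_semidef_add: "pos_semidef A \<Longrightarrow> pos_semidef B \<Longrightarrow> pos_semidef (A + B)"
  by (simp add: pos_semidef_iff conj_transpose_add matrix_vector_mult_add_rdistrib inner_add_right)

lemma pos_semidef_scaleR:
  assumes "pos_semidef A" "0 \<le> c"
  shows "pos_semidef (c *\<^sub>R A)"
proof -
  have "(c *\<^sub>R A) *v x = c *\<^sub>R (A *v x)" for x
    by (simp add: vec_eq_iff matrix_vector_mult_def scaleR_sum_right)
  with assms show ?thesis
    by (simp add: pos_semidef_iff conj_transpose_scaleR)
qed

lemma pos_semidef_congruence:
  assumes "pos_semidef A"
  shows "pos_semidef (X ** A ** conj_transpose X)"
proof -
  have "x \<bullet> (X ** A ** conj_transpose X *v x) = (conj_transpose X *v x) \<bullet> (A *v (conj_transpose X *v x))" for x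
    by (simp add: inner_conj_transpose[of _ X] flip: matrix_vector_mul_assoc)
  with assms show ?thesis
    by (simp add: pos_semidef_iff conj_transpose_mult matrix_mul_assoc)
qed

text \<open>By Cauchy-Schwarz the form of \<open>A\<close> at \<open>x\<close> is at most
  \<open>op_norm A\<close> times the squared norm of \<open>x\<close>. The difference is the
  direction in which traces of powers will be differentiated.\<close>

lemma pos_semidef_op_norm_diff:
  assumes "conj_transpose A = A"
  shows "pos_semidef (op_norm A *\<^sub>R mat 1 - A)"
proof -
  have "x \<bullet> (A *v x) \<le> x \<bullet> ((op_norm A *\<^sub>R mat 1) *v x)" for x
  proof -
    have "x \<bullet> (A *v x) \<le> norm x * norm (A *v x)"
      by (rule norm_cauchy_schwarz)
    also have "\<dots> \<le> norm x * (op_norm A * norm x)"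
      unfolding op_norm_def
      by (intro mult_left_mono onorm bounded_linear_matrix_vector norm_ge_zero)
    also have "\<dots> = x \<bullet> (op_norm A *\<^sub>R x)"
      by (simp add: dot_square_norm power2_eq_square)
    also have "op_norm A *\<^sub>R x = (op_norm A *\<^sub>R mat 1) *v x"
      by (simp add: vec_eq_iff matrix_vector_mult_def mat_def if_distrib if_distribR
          cong: if_cong)
    finally show ?thesis .
  qed
  then show ?thesis
    using assms
    by (simp add: pos_semidef_iff conj_transpose_diff conj_transpose_scaleR
        matrix_vector_mult_diff_rdistrib inner_diff_right)
qed

section \<open>Rank-one matrices and Cholesky factorization\<close>

definition rank_one :: "complex^'n \<Rightarrow> complex^'n^'n" where
  "rank_one w = (\<chi> i j. w $ i * cnj (w $ j))"

text \<open>Both sides equal the squared norm of \<open>w\<close>. This equality on rank-one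
  matrices is what lets the triangle inequality yield \<open>norm_le_re_trace\<close>.\<close>

lemma norm_rank_one: "norm (rank_one w) = Re (trace (rank_one w))"
proof -
  have "norm (rank_one w $ i) = cmod (w $ i) * norm w" for i
    by (simp add: norm_vec_def rank_one_def norm_mult L2_set_right_distrib)
  then have "norm (rank_one w) = norm w * norm w"
    by (simp add: norm_vec_def[of "rank_one w"] L2_set_left_distrib[symmetric])
      (simp add: norm_vec_def)
  also have "\<dots> = (\<Sum>i\<in>UNIV. (cmod (w $ i))\<^sup>2)"
    by (simp add: norm_vec_def L2_set_def sum_nonneg)
  also have "\<dots> = Re (trace (rank_one w))"
    by (simp add: trace_def rank_one_def complex_mult_cnj cmod_def)
  finally show ?thesis .
qed

lemma trace_mult_rank_one: "Re (trace (P ** rank_one w)) = w \<bullet> (P *v w)"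
proof -
  have "trace (P ** rank_one w) = (\<Sum>i\<in>UNIV. \<Sum>j\<in>UNIV. cnj (w $ i) * (P $ i $ j * w $ j))"
    by (simp add: trace_def matrix_matrix_mult_def rank_one_def mult_ac)
  then show ?thesis
    by (simp add: inner_vec_def inner_complex_def matrix_vector_mult_def sum_distrib_left
        flip: sum.distrib)
qed

lemma inner_rank_one: "x \<bullet> (rank_one w *v x) = (cmod (\<Sum>i\<in>UNIV. cnj (w $ i) * x $ i))\<^sup>2"
proof -
  define b where "b = (\<Sum>i\<in>UNIV. cnj (w $ i) * x $ i)"
  have "rank_one w *v x = (\<chi> i. w $ i * b)"
    by (simp add: vec_eq_iff rank_one_def matrix_vector_mult_def b_def sum_distrib_left mult_ac)
  then have "x \<bullet> (rank_one w *v x) = Re (\<Sum>i\<in>UNIV. cnj (x $ i) * w $ i * b)"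
    by (simp add: inner_vec_def inner_complex_def algebra_simps)
  also have "\<dots> = Re (cnj b * b)"
    by (simp add: b_def sum_distrib_right mult_ac)
  also have "\<dots> = (cmod b)\<^sup>2"
    by (simp add: cmod_def power2_eq_square)
  finally show ?thesis by (simp add: b_def)
qed

text \<open>This is the form at x - e, where e is supported at index \<open>s\<close> with entry
  \<open>t\<close> times (A x)_s. It is kept as a polynomial in \<open>t\<close> so that deflation
  can choose \<open>t\<close>.\<close>

lemma pos_semidef_shift:
  assumes "pos_semidef A"
  shows "0 \<le> x \<bullet> (A *v x) - 2 * t * (cmod ((A *v x) $ s))\<^sup>2
    + t\<^sup>2 * (cmod ((A *v x) $ s))\<^sup>2 * Re (A $ s $ s)"
proof -
  define b where "b = (A *v x) $ s"
  define e where "e = axis s (t *\<^sub>R b)"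
  have e1: "(A *v x) \<bullet> e = t * (cmod b)\<^sup>2"
    by (simp add: e_def inner_axis b_def dot_square_norm)
  have "(A *v e) $ s = A $ s $ s * (t *\<^sub>R b)"
    by (simp add: e_def matrix_vector_mult_def axis_def if_distrib cong: if_cong)
  then have e2: "e \<bullet> (A *v e) = t\<^sup>2 * (cmod b)\<^sup>2 * Re (A $ s $ s)"
    by (simp add: e_def inner_axis' inner_complex_def power2_eq_square cmod_def algebra_simps)
  have e3: "x \<bullet> (A *v e) = (A *v x) \<bullet> e"
    using pos_semidefD(1)[OF assms] by (simp add: inner_conj_transpose)
  have "0 \<le> (x - e) \<bullet> (A *v (x - e))"
    by (rule pos_semidefD(2)[OF assms])
  also have "\<dots> = x \<bullet> (A *v x) - 2 * ((A *v x) \<bullet> e) + e \<bullet> (A *v e)"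
    using e3 by (simp add: matrix_vector_mult_diff_distrib inner_diff_left inner_diff_right inner_commute)
  finally show ?thesis
    unfolding e1 e2 b_def by simp
qed

text \<open>One step of Cholesky factorization, removing the row and the column of index \<open>s\<close>.\<close>

lemma pos_semidef_deflate:
  assumes "pos_semidef A"
  obtains w where "pos_semidef (A - rank_one w)"
    "\<And>i. (A - rank_one w) $ s $ i = 0"
    "\<And>i j. A $ i $ s = 0 \<Longrightarrow> (rank_one w) $ i $ j = 0 \<and> rank_one w $ j $ i = 0"
proof -
  define a where "a = Re (A $ s $ s)"
  have herm: "cnj (A $ i $ j) = A $ j $ i" for i j
    using pos_semidefD(1)[OF assms] by (metis conj_transpose_nth)
  have diag: "A $ s $ s = of_real a"
    using herm[of s s] by (simp add: a_def complex_eq_iff)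
  have col: "(A *v axis j 1) $ i = A $ i $ j" for i j
    by (simp add: matrix_vector_mult_def axis_def if_distrib cong: if_cong)
  have a0: "0 \<le> a"
    using pos_semidefD(2)[OF assms, of "axis s 1"] by (simp add: inner_axis' col a_def)
  show thesis
  proof (cases "a = 0")
    case True
    \<comment> \<open>With a zero pivot the polynomial of \<open>pos_semidef_shift\<close> is affine
      in \<open>t\<close> with slope -2b; at t = (q + 1) / b it equals -q - 2 < 0.\<close>
    have "A $ s $ j = 0" for j
    proof (rule ccontr)
      define q b where "q = axis j 1 \<bullet> (A *v axis j 1)" and "b = (cmod (A $ s $ j))\<^sup>2"
      assume "A $ s $ j \<noteq> 0"
      then have "b > 0" by (simp add: b_def)
      have "0 \<le> q - 2 * ((q + 1) / b) * b"
        using pos_semidef_shift[OF assms, of "axis j 1" "(q + 1) / b" s] True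
        by (simp add: col q_def b_def a_def)
      moreover have "0 \<le> q"
        unfolding q_def by (rule pos_semidefD(2)[OF assms])
      ultimately show False using \<open>b > 0\<close> by simp
    qed
    then show ?thesis
      using assms by (intro that[of 0]) (simp_all add: rank_one_def zero_vec_def[symmetric])
  next
    case False
    with a0 have a: "a > 0" by simp
    \<comment> \<open>Column \<open>s\<close> over the square root of the pivot:
      \<open>rank_one w\<close> agrees with \<open>A\<close> in row and column \<open>s\<close>, and
      subtracting it leaves the Schur complement.\<close>
    define w where "w = (\<chi> i. A $ i $ s / of_real (sqrt a))"
    have sq: "complex_of_real (sqrt a) * complex_of_real (sqrt a) = of_real a"
      using a by (simp flip: of_real_mult)
    have w: "rank_one w $ i $ j = A $ i $ s * A $ s $ j / of_real a" for i j
      by (simp add: rank_one_def w_def herm sq)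
    have "pos_semidef (A - rank_one w)"
      unfolding pos_semidef_iff
    proof (intro conjI allI)
      show "conj_transpose (A - rank_one w) = A - rank_one w"
        by (simp add: vec_eq_iff w herm mult.commute)
    next
      fix x
      define b where "b = (A *v x) $ s"
      have "(\<Sum>i\<in>UNIV. cnj (w $ i) * x $ i) = b / of_real (sqrt a)"
        by (simp add: w_def herm b_def matrix_vector_mult_def sum_divide_distrib)
      then have r: "x \<bullet> (rank_one w *v x) = (cmod b)\<^sup>2 / a"
        using a by (simp add: inner_rank_one norm_divide power_divide)
      \<comment> \<open>The choice t = 1 / a minimizes the polynomial and leaves exactly the form of
        the Schur complement.\<close>
      have "0 \<le> x \<bullet> (A *v x) - 2 * (1 / a) * (cmod b)\<^sup>2 + (1 / a)\<^sup>2 * (cmod b)\<^sup>2 * a"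
        using pos_semidef_shift[OF assms, of x "1 / a" s] unfolding a_def b_def .
      also have "\<dots> = x \<bullet> (A *v x) - (cmod b)\<^sup>2 / a"
        using a by (simp add: field_simps power2_eq_square)
      finally show "0 \<le> x \<bullet> ((A - rank_one w) *v x)"
        by (simp add: matrix_vector_mult_diff_rdistrib inner_diff_right r)
    qed
    moreover have "(A - rank_one w) $ s $ i = 0" for i
      using a by (simp add: w diag)
    moreover have "rank_one w $ i $ j = 0 \<and> rank_one w $ j $ i = 0" if "A $ i $ s = 0" for i j
      using that herm[of i s] by (simp add: w)
    ultimately show ?thesis by (rule that)
  qed
qed

text \<open>\<open>S\<close> contains the indices of the rows that may still be nonzero. Each
  deflation removes one index, and the third property in \<open>pos_semidef_deflate\<close> keeps
  rows that are already zero at zero.\<close>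

lemma pos_semidef_sum_rank_one_aux:
  assumes "finite S" "pos_semidef A" "\<And>i j. i \<notin> S \<Longrightarrow> A $ i $ j = 0"
  shows "\<exists>w. A = (\<Sum>s\<in>S. rank_one (w s))"
  using assms
proof (induction S arbitrary: A rule: finite_induct)
  case empty
  then show ?case by (simp add: vec_eq_iff)
next
  case (insert s S)
  obtain v where v: "pos_semidef (A - rank_one v)"
    "\<And>i. (A - rank_one v) $ s $ i = 0"
    "\<And>i j. A $ i $ s = 0 \<Longrightarrow> (rank_one v) $ i $ j = 0 \<and> rank_one v $ j $ i = 0"
    using pos_semidef_deflate[OF insert.prems(1)] by metis
  have "(A - rank_one v) $ i $ j = 0" if "i \<notin> S" for i j
  proof (cases "i = s")
    case False
    with that show ?thesis using insert.prems(2)[of i] v(3)[of i j] by simp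
  qed (use v(2) in simp)
  from insert.IH[OF v(1) this] obtain w where "A - rank_one v = (\<Sum>s\<in>S. rank_one (w s))"
    by blast
  then have "A = rank_one v + (\<Sum>s\<in>S. rank_one (w s))"
    by (simp add: algebra_simps)
  also have "\<dots> = (\<Sum>t\<in>insert s S. rank_one ((w(s := v)) t))"
    using insert.hyps by simp (intro sum.cong, auto)
  finally show ?case by blast
qed

lemma pos_semidef_sum_rank_one:
  assumes "pos_semidef (A :: complex^'n^'n)"
  obtains w :: "'n \<Rightarrow> complex^'n" where "A = (\<Sum>s\<in>UNIV. rank_one (w s))"
  using pos_semidef_sum_rank_one_aux[OF finite_class.finite_UNIV assms] by auto

lemma norm_le_re_trace:
  assumes "pos_semidef (A :: complex^'n^'n)"
  shows "norm A \<le> re_trace A"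
proof -
  obtain w :: "'n \<Rightarrow> complex^'n" where w: "A = (\<Sum>s\<in>UNIV. rank_one (w s))"
    using pos_semidef_sum_rank_one[OF assms] .
  have "norm A \<le> (\<Sum>s\<in>UNIV. norm (rank_one (w s)))"
    unfolding w by (rule norm_sum)
  also have "\<dots> = Re (trace A)"
    by (simp add: w norm_rank_one linear_sum[OF bounded_linear.linear[OF bounded_linear_trace]])
  finally show ?thesis by (simp add: re_trace_def)
qed

text \<open>The trace is real because the adjoint swaps the factors and cyclicity swaps them back.
  Splitting \<open>Q\<close> into rank-one matrices writes it as a sum of values of the form of
  \<open>P\<close>, whence the sign.\<close>

lemma trace_mult_pos_semidef:
  assumes "pos_semidef (P :: complex^'n^'n)" "pos_semidef Q"
  shows "Im (trace (P ** Q)) = 0" "0 \<le> Re (trace (P ** Q))"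
proof -
  have "cnj (trace (P ** Q)) = trace (Q ** P)"
    using assms by (simp add: conj_transpose_mult pos_semidefD(1) flip: trace_conj_transpose)
  then show "Im (trace (P ** Q)) = 0"
    by (simp add: trace_mul_sym[of Q] complex_eq_iff)
  obtain w :: "'n \<Rightarrow> complex^'n" where w: "Q = (\<Sum>s\<in>UNIV. rank_one (w s))"
    using pos_semidef_sum_rank_one[OF assms(2)] .
  have "Re (trace (P ** Q)) = (\<Sum>s\<in>UNIV. Re (trace (P ** rank_one (w s))))"
    by (simp add: w linear_sum[OF bounded_linear.linear[OF bounded_linear_trace]]
        bounded_bilinear.sum_right[OF bounded_bilinear_matrix_mult])
  also have "\<dots> \<ge> 0"
    using assms(1) by (intro sum_nonneg) (simp add: trace_mult_rank_one pos_semidefD)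
  finally show "0 \<le> Re (trace (P ** Q))" .
qed

section \<open>The Frobenius norm and matrix powers\<close>

text \<open>Cauchy-Schwarz for the Hilbert-Schmidt inner product: the trace pairs X_ij with Y_ji.
  Double sums are flattened to sums over index pairs so that \<open>L2_set_mult_ineq\<close>
  applies.\<close>

lemma cmod_trace_mult_le: "cmod (trace (X ** Y)) \<le> norm X * norm (Y :: complex^'n^'n)"
proof -
  have t: "(\<Sum>i\<in>UNIV. \<Sum>j\<in>UNIV. (cmod (Z $ i $ j))\<^sup>2) = (norm Z)\<^sup>2" for Z :: "complex^'n^'n"
    by (simp add: norm_vec_def L2_set_def sum_nonneg)
  have p: "(\<Sum>i\<in>UNIV. \<Sum>j\<in>UNIV. f i j) = (\<Sum>p\<in>UNIV. f (fst p) (snd p))" for f :: "'n \<Rightarrow> 'n \<Rightarrow> real"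
    by (simp add: sum.cartesian_product case_prod_beta)
  have "cmod (trace (X ** Y)) \<le> (\<Sum>i\<in>UNIV. cmod (\<Sum>j\<in>UNIV. X $ i $ j * Y $ j $ i))"
    unfolding trace_def matrix_matrix_mult_def by (simp add: norm_sum)
  also have "\<dots> \<le> (\<Sum>i\<in>UNIV. \<Sum>j\<in>UNIV. cmod (X $ i $ j) * cmod (Y $ j $ i))"
    by (intro sum_mono order_trans[OF norm_sum]) (simp add: norm_mult)
  also have "\<dots> = (\<Sum>p\<in>UNIV. cmod (X $ fst p $ snd p) * cmod (Y $ snd p $ fst p))"
    by (rule p)
  also have "\<dots> \<le> L2_set (\<lambda>p. cmod (X $ fst p $ snd p)) UNIV * L2_set (\<lambda>p. cmod (Y $ snd p $ fst p)) UNIV"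
    using L2_set_mult_ineq[of "\<lambda>p. cmod (X $ fst p $ snd p)" "\<lambda>p. cmod (Y $ snd p $ fst p)" UNIV]
    by simp
  also have "L2_set (\<lambda>p. cmod (X $ fst p $ snd p)) UNIV = norm X"
    using t[of X] p[of "\<lambda>i j. (cmod (X $ i $ j))\<^sup>2"] by (simp add: L2_set_def)
  also have "L2_set (\<lambda>p. cmod (Y $ snd p $ fst p)) UNIV = norm Y"
  proof -
    have "(\<Sum>p\<in>UNIV. (cmod (Y $ snd p $ fst p))\<^sup>2) = (norm Y)\<^sup>2"
      unfolding t[of Y, symmetric] p[of "\<lambda>i j. (cmod (Y $ j $ i))\<^sup>2", symmetric] by (rule sum.swap)
    then show ?thesis by (simp add: L2_set_def)
  qed
  finally show ?thesis .
qed

lemma trace_mult_conj_transpose: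
  "trace (X ** conj_transpose X) = complex_of_real ((norm X)\<^sup>2)"
  by (simp add: trace_def matrix_matrix_mult_def complex_norm_square norm_vec_def L2_set_def
      sum_nonneg del: of_real_power)

lemma norm_conj_transpose: "norm (conj_transpose X) = norm (X :: complex^'n^'n)"
proof -
  have "complex_of_real ((norm (conj_transpose X))\<^sup>2) = trace (conj_transpose X ** X)"
    using trace_mult_conj_transpose[of "conj_transpose X"] by simp
  also have "\<dots> = complex_of_real ((norm X)\<^sup>2)"
    by (simp only: trace_mul_sym[of "conj_transpose X"] trace_mult_conj_transpose)
  finally show ?thesis
    by (simp only: of_real_eq_iff power2_eq_iff_nonneg norm_ge_zero)
qed

text \<open>Cauchy-Schwarz bounds each entry by a row of \<open>X\<close> times a column of
  \<open>Y\<close>; the columns appear as rows of the adjoint \<open>Z\<close>.\<close>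

lemma norm_matrix_mult_le: "norm (X ** Y) \<le> norm X * norm (Y :: complex^'n^'n)"
proof -
  define Z where "Z = conj_transpose Y"
  have row: "norm ((X ** Y) $ i) \<le> norm (X $ i) * norm Y" for i
  proof -
    have "cmod ((X ** Y) $ i $ j) \<le> norm (X $ i) * norm (Z $ j)" for j
    proof -
      have "cmod ((X ** Y) $ i $ j) \<le> (\<Sum>k\<in>UNIV. cmod (X $ i $ k) * cmod (Z $ j $ k))"
        by (auto simp: matrix_matrix_mult_def Z_def norm_mult intro!: order_trans[OF norm_sum])
      also have "\<dots> \<le> norm (X $ i) * norm (Z $ j)"
        using L2_set_mult_ineq[of "\<lambda>k. cmod (X $ i $ k)" "\<lambda>k. cmod (Z $ j $ k)" UNIV]
        by (simp add: norm_vec_def)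
      finally show ?thesis .
    qed
    then have "norm ((X ** Y) $ i) \<le> L2_set (\<lambda>j. norm (X $ i) * norm (Z $ j)) UNIV"
      unfolding norm_vec_def[of "(X ** Y) $ i"] by (intro L2_set_mono) auto
    also have "\<dots> = norm (X $ i) * norm Z"
      by (simp add: L2_set_right_distrib[symmetric] norm_vec_def[of Z])
    finally show ?thesis by (simp add: Z_def norm_conj_transpose)
  qed
  have "norm (X ** Y) \<le> L2_set (\<lambda>i. norm (X $ i) * norm Y) UNIV"
    unfolding norm_vec_def[of "X ** Y"] using row by (intro L2_set_mono) auto
  also have "\<dots> = norm X * norm Y"
    by (simp add: L2_set_left_distrib[symmetric] norm_vec_def[of X])
  finally show ?thesis .
qed

lemma op_norm_le_norm:
  fixes A :: "complex^'n^'n"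
  shows "op_norm A \<le> norm A"
  unfolding op_norm_def
proof (rule onorm_le)
  fix x :: "complex^'n"
  have "norm ((A *v x) $ i) \<le> norm (A $ i) * norm x" for i
  proof -
    have "norm ((A *v x) $ i) \<le> (\<Sum>j\<in>UNIV. cmod (A $ i $ j) * cmod (x $ j))"
      by (auto simp: matrix_vector_mult_def norm_mult intro!: order_trans[OF norm_sum])
    also have "\<dots> \<le> norm (A $ i) * norm x"
      using L2_set_mult_ineq[of "\<lambda>j. cmod (A $ i $ j)" "\<lambda>j. cmod (x $ j)" UNIV]
      by (simp add: norm_vec_def)
    finally show ?thesis .
  qed
  then have "norm (A *v x) \<le> L2_set (\<lambda>i. norm (A $ i) * norm x) UNIV"
    unfolding norm_vec_def[of "A *v x"] by (intro L2_set_mono) auto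
  also have "\<dots> = norm A * norm x"
    by (simp add: L2_set_left_distrib[symmetric] norm_vec_def[of A])
  finally show "norm (A *v x) \<le> norm A * norm x" .
qed

section \<open>Algebra and growth of matrix powers\<close>

lemma mat_pow_add: "mat_pow T (j + k) = mat_pow T j ** mat_pow T k"
  by (induction j) (simp_all add: matrix_mul_assoc)

lemma mat_pow_Suc_right: "mat_pow T (Suc k) = mat_pow T k ** T"
  using mat_pow_add[of T k 1] by simp

lemma mat_pow_double: "mat_pow (T ** T) k = mat_pow T (2 * k)"
  by (induction k) (simp_all add: matrix_mul_assoc)

lemma mat_pow_mult_shift: "X ** mat_pow (Y ** X) k = mat_pow (X ** Y) k ** X"
  by (induction k) (simp_all flip: matrix_mul_assoc)

lemma conj_transpose_mat_pow: "conj_transpose (mat_pow T k) = mat_pow (conj_transpose T) k"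
  by (induction k) (simp_all add: conj_transpose_mult mat_pow_Suc_right[simplified])

lemma scaleR_matrix_mult:
  "(c *\<^sub>R X) ** Y = c *\<^sub>R (X ** Y)" "X ** (c *\<^sub>R Y) = c *\<^sub>R (X ** (Y :: complex^'n^'n))"
  by (simp_all add: bounded_bilinear.scaleR_left[OF bounded_bilinear_matrix_mult]
      bounded_bilinear.scaleR_right[OF bounded_bilinear_matrix_mult])

lemma mat_pow_scaleR: "mat_pow (c *\<^sub>R T) k = c ^ k *\<^sub>R mat_pow T k"
  by (induction k) (simp_all add: scaleR_matrix_mult)

text \<open>The factor \<open>norm (mat 1)\<close> accounts for the power 0, since the Frobenius
  norm of the identity is sqrt n.\<close>

lemma norm_mat_pow_le: "norm (mat_pow T k) \<le> norm (mat 1 :: complex^'n^'n) * norm (T :: complex^'n^'n) ^ k"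
proof (induction k)
  case (Suc k)
  have "norm (mat_pow T (Suc k)) \<le> norm T * norm (mat_pow T k)"
    by (simp add: norm_matrix_mult_le)
  also have "\<dots> \<le> norm T * (norm (mat 1 :: complex^'n^'n) * norm T ^ k)"
    by (intro mult_left_mono Suc.IH) simp
  finally show ?case by (simp add: mult_ac)
qed simp

lemma trace_mat_pow_commute:
  fixes X Y :: "complex^'n^'n"
  shows "trace (mat_pow (X ** Y) k) = trace (mat_pow (Y ** X) k)"
proof (cases k)
  case (Suc m)
  have "trace (mat_pow (X ** Y) k) = trace (X ** (Y ** mat_pow (X ** Y) m))"
    by (simp add: Suc matrix_mul_assoc)
  also have "\<dots> = trace (Y ** mat_pow (X ** Y) m ** X)"
    by (rule trace_mul_sym)
  also have "\<dots> = trace (mat_pow (Y ** X) m ** (Y ** X))"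
    by (simp add: mat_pow_mult_shift matrix_mul_assoc)
  also have "\<dots> = trace (mat_pow (Y ** X) k)"
    by (simp add: Suc mat_pow_Suc_right[simplified])
  finally show ?thesis .
qed simp

section \<open>The chessboard estimate\<close>

text \<open>Words are lists so that cutting, rotating and reflecting them are list
  operations.\<close>

definition word_prod :: "(complex^'n^'n) list \<Rightarrow> complex^'n^'n" where
  "word_prod w = foldr (**) w (mat 1)"

lemma word_prod_simps [simp]:
  "word_prod [] = mat 1" "word_prod (X # w) = X ** word_prod w"
  by (simp_all add: word_prod_def)

lemma word_prod_append: "word_prod (u @ v) = word_prod u ** word_prod v"
  by (induction u) (simp_all add: matrix_mul_assoc)

lemma word_prod_rev:
  assumes "\<And>X. X \<in> set w \<Longrightarrow> conj_transpose X = X"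
  shows "word_prod (rev w) = conj_transpose (word_prod w)"
  using assms by (induction w) (simp_all add: word_prod_append conj_transpose_mult)

lemma word_prod_replicate: "word_prod (replicate k X) = mat_pow X k"
  by (induction k) simp_all

lemma word_prod_alternating:
  "word_prod (concat (replicate k [X, Y])) = mat_pow (X ** Y) k"
  by (induction k) (simp_all add: matrix_mul_assoc)

lemma trace_word_append: "trace (word_prod (u @ v)) = trace (word_prod (v @ u))"
  by (simp only: word_prod_append trace_mul_sym[of "word_prod u"])

text \<open>For Hermitian letters \<open>rev\<close> acts as the adjoint, so the trace of
  \<open>u @ rev u\<close> is the squared Frobenius norm of \<open>word_prod u\<close>. The claim is
  then the square of \<open>cmod_trace_mult_le\<close>.\<close>

lemma trace_word_Cauchy_Schwarz:
  assumes "\<And>X. X \<in> set (u @ v) \<Longrightarrow> conj_transpose X = X"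
  shows "(cmod (trace (word_prod (u @ v))))\<^sup>2
    \<le> cmod (trace (word_prod (u @ rev u))) * cmod (trace (word_prod (v @ rev v)))"
proof -
  have sq: "cmod (trace (word_prod (w @ rev w))) = (norm (word_prod w))\<^sup>2"
    if "\<And>X. X \<in> set w \<Longrightarrow> conj_transpose X = X" for w :: "(complex^'n^'n) list"
    using that by (simp add: word_prod_append word_prod_rev trace_mult_conj_transpose
        del: of_real_power)
  have "cmod (trace (word_prod (u @ v))) \<le> norm (word_prod u) * norm (word_prod v)"
    by (simp add: word_prod_append cmod_trace_mult_le)
  then have "(cmod (trace (word_prod (u @ v))))\<^sup>2 \<le> (norm (word_prod u) * norm (word_prod v))\<^sup>2"
    by (intro power_mono) auto
  then show ?thesis
    using assms by (simp add: sq power_mult_distrib)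
qed

text \<open>The chessboard estimate: reflecting a maximizing word in a cut through one of its runs doubles
  the run, so some constant word is maximizing.\<close>

lemma trace_word_le_1:
  fixes L :: "(complex^'n^'n) set"
  assumes letters: "finite L" "\<And>X. X \<in> L \<Longrightarrow> conj_transpose X = X"
    and pure: "\<And>X. X \<in> L \<Longrightarrow> cmod (trace (mat_pow X (2 * k))) \<le> 1"
    and w: "set w \<subseteq> L" "length w = 2 * k" and k: "0 < k"
  shows "cmod (trace (word_prod w)) \<le> 1"
proof -
  define F :: "(complex^'n^'n) list \<Rightarrow> real" where "F w = cmod (trace (word_prod w))" for w
  define W where "W = {w. set w \<subseteq> L \<and> length w = 2 * k}"
  have "finite W"
    unfolding W_def using letters(1) by (rule finite_lists_length_eq)
  have "w \<in> W" using w by (simp add: W_def)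
  then have "Max (F ` W) \<in> F ` W"
    using \<open>finite W\<close> by (intro Max_in) auto
  then obtain w0 where w0: "w0 \<in> W" "\<And>v. v \<in> W \<Longrightarrow> F v \<le> F w0"
    using \<open>finite W\<close> by (metis Max_ge finite_imageI image_eqI imageE)
  define M where "M = F w0"
  have "M \<le> 1"
  proof (cases "M = 0")
    case False
    then have M: "M > 0" by (simp add: M_def F_def)
    \<comment> \<open>The reflection of a maximizer is a maximizer: M^2 \<le> F (u @ rev u) F (v @
      rev v) \<le> F (u @ rev u) M, and M > 0 cancels.\<close>
    have reflect: "F (u @ rev u) = M"
      if "u @ v \<in> W" "F (u @ v) = M" "length u = k" for u v
    proof (rule antisym)
      have mem: "u @ rev u \<in> W" "v @ rev v \<in> W"
        using that by (auto simp: W_def)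
      show "F (u @ rev u) \<le> M"
        unfolding M_def by (rule w0(2)[OF mem(1)])
      have "(F (u @ v))\<^sup>2 \<le> F (u @ rev u) * F (v @ rev v)"
        unfolding F_def
        by (rule trace_word_Cauchy_Schwarz) (use that letters(2) in \<open>auto simp: W_def\<close>)
      then have "M * M \<le> F (u @ rev u) * F (v @ rev v)"
        by (simp add: that power2_eq_square)
      also have "\<dots> \<le> F (u @ rev u) * M"
        unfolding M_def by (intro mult_left_mono w0(2) mem) (simp add: F_def)
      finally show "M \<le> F (u @ rev u)" using M by simp
    qed
    define X where "X = hd w0"
    \<comment> \<open>\<open>P r\<close> says that some maximizer begins with \<open>r\<close>
      copies of \<open>X\<close>; word length bounds \<open>r\<close>, so a greatest one
      exists.\<close>
    define P where "P r \<longleftrightarrow> (\<exists>v. replicate r X @ v \<in> W \<and> F (replicate r X @ v) = M)" for r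
    have bound: "r \<le> 2 * k" if "P r" for r
      using that by (auto simp: P_def W_def)
    have "w0 = replicate 1 X @ tl w0"
      using w0(1) k by (cases w0) (auto simp: W_def X_def)
    then have "P 1" unfolding P_def M_def using w0(1) by metis
    define r where "r = (GREATEST r. P r)"
    have r: "P r" "\<And>s. P s \<Longrightarrow> s \<le> r"
      unfolding r_def using GreatestI_nat[of P, OF \<open>P 1\<close> bound] Greatest_le_nat[of P _ "2 * k"] bound
      by blast+
    have "1 \<le> r" using r(2) \<open>P 1\<close> .
    obtain v where v: "replicate r X @ v \<in> W" "F (replicate r X @ v) = M"
      using r(1) by (auto simp: P_def)
    have "k \<le> r"
    proof (rule ccontr)
      assume "\<not> k \<le> r"
      \<comment> \<open>\<open>q\<close> completes the run to half a word. Reflection puts a second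
        run of \<open>X\<close> at the end, and rotating it to the front gives a run of length 2r,
        against the maximality of \<open>r\<close>.\<close>
      define q where "q = take (k - r) v"
      have len: "length (replicate r X @ q) = k"
        using \<open>\<not> k \<le> r\<close> v(1) by (auto simp: q_def W_def)
      have eq: "replicate r X @ v = (replicate r X @ q) @ drop (k - r) v"
        by (simp add: q_def)
      have "F ((replicate r X @ q) @ rev (replicate r X @ q)) = M"
        using reflect[of "replicate r X @ q" "drop (k - r) v"] v len unfolding eq[symmetric] by blast
      also have "F ((replicate r X @ q) @ rev (replicate r X @ q))
          = F (replicate r X @ (replicate r X @ q @ rev q))"
        unfolding F_def using trace_word_append[of "replicate r X @ q @ rev q" "replicate r X"] by simp
      finally have "F (replicate (r + r) X @ (q @ rev q)) = M"
        by (simp add: replicate_add)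
      moreover have "replicate (r + r) X @ (q @ rev q) \<in> W"
        using v(1) len by (auto simp: W_def q_def dest: in_set_takeD)
      ultimately have "P (r + r)" unfolding P_def by blast
      then show False using r(2)[of "r + r"] \<open>1 \<le> r\<close> by simp
    qed
    \<comment> \<open>Now the run fills a half, whose reflection is the constant word.\<close>
    then have "replicate r X @ v = replicate k X @ (replicate (r - k) X @ v)"
      by (simp flip: append_assoc replicate_add)
    then have "F (replicate k X @ rev (replicate k X)) = M"
      using reflect[of "replicate k X"] v by (metis length_replicate)
    then have "M = cmod (trace (mat_pow X (2 * k)))"
      by (simp add: F_def mult_2 word_prod_replicate flip: replicate_add)
    moreover have "X \<in> L"
      using v(1) \<open>1 \<le> r\<close> by (auto simp: W_def)
    ultimately show ?thesis using pure by simp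
  qed simp
  then show ?thesis
    using w0(2)[OF \<open>w \<in> W\<close>] by (simp add: M_def F_def)
qed

lemma trace_mat_pow_even:
  assumes "conj_transpose A = A"
  shows "trace (mat_pow A (2 * k)) = complex_of_real ((norm (mat_pow A k))\<^sup>2)"
  using trace_mult_conj_transpose[of "mat_pow A k"]
  by (simp add: mult_2 mat_pow_add conj_transpose_mat_pow assms)

text \<open>Rescaling brings the traces of both even powers to at most 1, and the chessboard
  estimate is applied to the alternating word in the rescaled letters.\<close>

lemma trace_mat_pow_mult_le:
  assumes A: "conj_transpose A = A" and B: "conj_transpose B = (B :: complex^'n^'n)"
  shows "(cmod (trace (mat_pow (A ** B) k)))\<^sup>2
    \<le> re_trace (mat_pow A (2 * k)) * re_trace (mat_pow B (2 * k))"
proof (cases "k = 0")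
  case True
  then show ?thesis
    by (simp add: re_trace_def trace_I norm_of_nat power2_eq_square)
next
  case False
  define a b where "a = (norm (mat_pow A k))\<^sup>2" and "b = (norm (mat_pow B k))\<^sup>2"
  define t where "t = cmod (trace (mat_pow (A ** B) k))"
  \<comment> \<open>The slack \<open>e\<close> keeps the scale factors positive when a power
    vanishes; it tends to 0 at the end. The 2k-th roots turn the rescaled traces into a / (a + e)
    and b / (b + e).\<close>
  have t: "t\<^sup>2 \<le> (a + e) * (b + e)" if "e > 0" for e
  proof -
    define x y where "x = root (2 * k) (a + e)" and "y = root (2 * k) (b + e)"
    have nonneg: "0 \<le> a" "0 \<le> b" by (simp_all add: a_def b_def)
    have x: "x ^ (2 * k) = a + e" "x > 0" and y: "y ^ (2 * k) = b + e" "y > 0"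
      using False that nonneg by (simp_all add: x_def y_def real_root_pow_pos)
    define A' B' where "A' = inverse x *\<^sub>R A" and "B' = inverse y *\<^sub>R B"
    have herm: "conj_transpose A' = A'" "conj_transpose B' = B'"
      by (simp_all add: A'_def B'_def conj_transpose_scaleR A B)
    have "cmod (trace (mat_pow A' (2 * k))) = a / (a + e)"
      "cmod (trace (mat_pow B' (2 * k))) = b / (b + e)"
      unfolding A'_def B'_def mat_pow_scaleR trace_scaleR trace_mat_pow_even[OF A]
        trace_mat_pow_even[OF B] a_def[symmetric] b_def[symmetric]
      using nonneg x y that
      by (simp_all add: power_inverse divide_inverse mult.commute)
    moreover have "a / (a + e) \<le> 1" "b / (b + e) \<le> 1"
      using nonneg that by simp_all
    ultimately have le1: "cmod (trace (mat_pow X (2 * k))) \<le> 1" if "X \<in> {A', B'}" for X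
      using that by auto
    have "cmod (trace (word_prod (concat (replicate k [A', B'])))) \<le> 1"
      by (rule trace_word_le_1[of "{A', B'}" k, OF _ _ le1])
        (use herm False in \<open>auto simp: length_concat sum_list_replicate\<close>)
    then have "t \<le> (x * y) ^ k"
      using x y
      by (simp add: word_prod_alternating A'_def B'_def scaleR_matrix_mult mat_pow_scaleR
          trace_scaleR norm_mult norm_power norm_inverse t_def divide_simps power_mult_distrib
          mult.commute flip: power_inverse)
    then have "t\<^sup>2 \<le> ((x * y) ^ k)\<^sup>2"
      by (intro power_mono) (simp_all add: t_def)
    also have "\<dots> = x ^ (2 * k) * y ^ (2 * k)"
      by (simp add: power_mult_distrib flip: power_mult) (simp add: mult.commute)
    finally show ?thesis using x y by simp
  qed
  have "((\<lambda>e. (a + e) * (b + e)) \<longlongrightarrow> (a + 0) * (b + 0)) (at_right 0)"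
    by (intro tendsto_intros)
  then have "t\<^sup>2 \<le> (a + 0) * (b + 0)"
    by (rule tendsto_lowerbound)
      (auto intro: eventually_mono[OF eventually_at_right_less[of 0]] t)
  then show ?thesis
    by (simp add: re_trace_def trace_mat_pow_even A B a_def b_def t_def)
qed

section \<open>Monotonicity of the trace of a power\<close>

text \<open>The product rule for the k-th power at \<open>Z\<close> in direction \<open>D\<close>,
  without assuming that they commute.\<close>

primrec mat_pow_deriv :: "complex^'n^'n \<Rightarrow> complex^'n^'n \<Rightarrow> nat \<Rightarrow> complex^'n^'n" where
  "mat_pow_deriv Z D 0 = 0"
| "mat_pow_deriv Z D (Suc k) = Z ** mat_pow_deriv Z D k + D ** mat_pow Z k"

lemma has_vector_derivative_mat_pow:
  fixes Z :: "real \<Rightarrow> complex^'n^'n"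
  assumes "(Z has_vector_derivative D) (at t)"
  shows "((\<lambda>t. mat_pow (Z t) k) has_vector_derivative mat_pow_deriv (Z t) D k) (at t)"
proof (induction k)
  case (Suc k)
  show ?case
    using bounded_bilinear.has_vector_derivative[OF bounded_bilinear_matrix_mult assms Suc.IH]
    by simp
qed simp

text \<open>The induction step absorbs a factor \<open>Z\<close> into \<open>Q\<close>, which is why
  an arbitrary \<open>Q\<close> commuting with \<open>Z\<close> is carried along; the case wanted is
  \<open>Q = mat 1\<close>.\<close>

lemma trace_mat_pow_deriv_aux:
  assumes "Q ** Z = Z ** Q"
  shows "trace (Q ** mat_pow_deriv Z D (Suc k)) = of_nat (Suc k) * trace (Q ** mat_pow Z k ** D)"
  using assms
proof (induction k arbitrary: Q)
  case 0
  then show ?case by simp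
next
  case (Suc k)
  have comm: "Q ** mat_pow Z j = mat_pow Z j ** Q" for j
    by (induction j) (simp_all add: Suc.prems matrix_mul_assoc, metis Suc.prems matrix_mul_assoc)
  have "trace (Q ** mat_pow_deriv Z D (Suc (Suc k)))
      = trace ((Q ** Z) ** mat_pow_deriv Z D (Suc k)) + trace (Q ** (D ** mat_pow Z (Suc k)))"
    by (simp add: matrix_add_ldistrib trace_add matrix_mul_assoc del: mat_pow.simps)
  also have "trace ((Q ** Z) ** mat_pow_deriv Z D (Suc k))
      = of_nat (Suc k) * trace ((Q ** Z) ** mat_pow Z k ** D)"
    by (rule Suc.IH) (metis Suc.prems matrix_mul_assoc)
  also have "(Q ** Z) ** mat_pow Z k = Q ** mat_pow Z (Suc k)"
    by (simp add: matrix_mul_assoc)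
  also have "trace (Q ** (D ** mat_pow Z (Suc k))) = trace (mat_pow Z (Suc k) ** Q ** D)"
    using trace_mul_sym[of "Q ** D" "mat_pow Z (Suc k)"] by (simp add: matrix_mul_assoc)
  also have "mat_pow Z (Suc k) ** Q = Q ** mat_pow Z (Suc k)"
    by (simp only: comm)
  finally show ?case by (simp add: algebra_simps del: mat_pow.simps mat_pow_deriv.simps)
qed

lemma trace_mat_pow_deriv:
  "trace (mat_pow_deriv Z D (Suc k)) = of_nat (Suc k) * trace (mat_pow Z k ** D)"
  using trace_mat_pow_deriv_aux[of "mat 1" Z D k] by simp

text \<open>The product is a palindrome with \<open>A\<close> or \<open>B\<close> in the middle.
  Congruence by \<open>B ** A\<close> raises the exponent by 2, hence the two base cases.\<close>

lemma pos_semidef_alternating: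
  assumes "pos_semidef A" "pos_semidef B"
  shows "pos_semidef (B ** mat_pow (A ** B) k)"
proof (induction k rule: nat_induct2)
  case 1
  have "B ** A ** conj_transpose B = B ** mat_pow (A ** B) 1"
    using pos_semidefD(1)[OF assms(2)] by (simp add: matrix_mul_assoc)
  then show ?case using pos_semidef_congruence[OF assms(1), of B] by simp
next
  case (step n)
  have "(B ** A) ** (B ** mat_pow (A ** B) n) ** conj_transpose (B ** A)
      = B ** (A ** B) ** (mat_pow (A ** B) n ** (A ** B))"
    using assms by (simp add: pos_semidefD(1) conj_transpose_mult matrix_mul_assoc)
  also have "mat_pow (A ** B) n ** (A ** B) = mat_pow (A ** B) (Suc n)"
    by (rule mat_pow_Suc_right[symmetric])
  also have "B ** (A ** B) ** mat_pow (A ** B) (Suc n) = B ** mat_pow (A ** B) (n + 2)"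
    by (simp add: matrix_mul_assoc)
  finally show ?case using pos_semidef_congruence[OF step, of "B ** A"] by simp
qed (use assms in simp)

text \<open>A positive power is \<open>A\<close> times a matrix from
  \<open>pos_semidef_alternating\<close>, so its trace is real and nonnegative.\<close>

lemma trace_mat_pow_mult_pos_semidef:
  assumes "pos_semidef A" "pos_semidef (B :: complex^'n^'n)"
  shows "cmod (trace (mat_pow (A ** B) k)) = re_trace (mat_pow (A ** B) k)"
proof (cases k)
  case 0
  then show ?thesis by (simp add: re_trace_def trace_I)
next
  case (Suc m)
  have "mat_pow (A ** B) k = A ** (B ** mat_pow (A ** B) m)"
    by (simp add: Suc matrix_mul_assoc)
  then show ?thesis
    using trace_mult_pos_semidef[OF assms(1) pos_semidef_alternating[OF assms, of m]]
    by (simp add: re_trace_def cmod_eq_Re)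
qed

text \<open>The derivative of \<open>tr ((A t B)\<^sup>k)\<close> along the segment \<open>A t\<close> from \<open>A\<close> to \<open>\<parallel>A\<parallel> I\<close>
  is \<open>k\<close> times the trace of a product of two positive semidefinite matrices.\<close>

lemma re_trace_mat_pow_mult_le:
  assumes "pos_semidef A" "pos_semidef (B :: complex^'n^'n)"
  shows "re_trace (mat_pow (A ** B) k) \<le> re_trace (mat_pow (op_norm A *\<^sub>R B) k)"
proof (cases k)
  case (Suc m)
  define D where "D = op_norm A *\<^sub>R mat 1 - A"
  define Z where "Z t = (A + t *\<^sub>R D) ** B" for t :: real
  have D: "pos_semidef D"
    unfolding D_def by (rule pos_semidef_op_norm_diff[OF pos_semidefD(1)[OF assms(1)]])
  have "((\<lambda>t. A + t *\<^sub>R D) has_vector_derivative D) (at t)" for t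
    by (auto intro!: derivative_eq_intros)
  then have Z': "(Z has_vector_derivative D ** B) (at t)" for t
    using bounded_bilinear.has_vector_derivative[OF bounded_bilinear_matrix_mult _ has_vector_derivative_const[of B]]
    unfolding Z_def by fastforce
  have bl: "bounded_linear (\<lambda>X :: complex^'n^'n. Re (trace X))"
    by (rule bounded_linear_compose[OF bounded_linear_Re bounded_linear_trace])
  have deriv: "((\<lambda>t. Re (trace (mat_pow (Z t) k))) has_real_derivative
      Re (trace (mat_pow_deriv (Z t) (D ** B) k))) (at t)" for t
    using bounded_linear.has_vector_derivative[OF bl has_vector_derivative_mat_pow[OF Z']]
    by (simp add: has_real_derivative_iff_has_vector_derivative)
  have nonneg: "0 \<le> Re (trace (mat_pow_deriv (Z t) (D ** B) k))" if "0 \<le> t" for t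
  proof -
    \<comment> \<open>Cyclicity moves \<open>B\<close> to the front, where it turns the power into a
      positive semidefinite palindrome.\<close>
    have "trace (mat_pow (Z t) m ** (D ** B)) = trace ((B ** mat_pow (Z t) m) ** D)"
      using trace_mul_sym[of "mat_pow (Z t) m ** D" B] by (simp add: matrix_mul_assoc)
    moreover have "pos_semidef (A + t *\<^sub>R D)"
      using assms(1) D that by (simp add: pos_semidef_add pos_semidef_scaleR)
    ultimately have "0 \<le> Re (trace (mat_pow (Z t) m ** (D ** B)))"
      unfolding Z_def using trace_mult_pos_semidef(2)[OF pos_semidef_alternating[OF _ assms(2)] D]
      by simp
    moreover have "Re (trace (mat_pow_deriv (Z t) (D ** B) k))
        = real (Suc m) * Re (trace (mat_pow (Z t) m ** (D ** B)))"
      unfolding Suc trace_mat_pow_deriv by (simp del: of_nat_Suc)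
    ultimately show ?thesis by simp
  qed
  \<comment> \<open>The endpoints are \<open>Z 0 = A ** B\<close> and
    \<open>Z 1 = op_norm A *\<^sub>R B\<close>.\<close>
  have "Re (trace (mat_pow (Z 0) k)) \<le> Re (trace (mat_pow (Z 1) k))"
    by (rule DERIV_nonneg_imp_nondecreasing[OF zero_le_one]) (use deriv nonneg in blast)
  then show ?thesis
    by (simp add: Z_def D_def re_trace_def scaleR_matrix_mult)
qed simp

lemma cmod_trace_mat_pow_mult_le:
  assumes "pos_semidef A" "pos_semidef (B :: complex^'n^'n)"
  shows "cmod (trace (mat_pow (A ** B) k)) \<le> re_trace (mat_pow (op_norm A *\<^sub>R B) k)"
  using re_trace_mat_pow_mult_le[OF assms] by (simp add: trace_mat_pow_mult_pos_semidef assms)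

section \<open>Power series\<close>

text \<open>Convergence at a radius strictly between \<open>r\<close> and \<open>R\<close> gives
  absolute convergence at \<open>r\<close>.\<close>

lemma summable_norm_power_series:
  assumes "\<forall>z\<in>eball 0 R. summable (\<lambda>k. \<alpha> k * z ^ k)" "ereal r < R" "0 \<le> r"
  shows "summable (\<lambda>k. cmod (\<alpha> k) * r ^ k)"
proof -
  obtain s where s: "ereal r < ereal s" "ereal s < R"
    using ereal_dense2[OF assms(2)] by blast
  then have "summable (\<lambda>k. \<alpha> k * complex_of_real s ^ k)"
    using assms by simp
  then have "summable (\<lambda>k. norm (\<alpha> k * complex_of_real r ^ k))"
    by (rule powser_insidea) (use s assms(3) in simp)
  then show ?thesis
    using assms(3) by (simp add: norm_mult norm_power)
qed

lemma scalar_matrix_mult_nth: "(mat c ** X) $ i $ j = c * (X $ i $ j :: complex)"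
  by (simp add: matrix_matrix_mult_def mat_def if_distrib if_distribR cong: if_cong)

text \<open>The matrix series converges absolutely in the Frobenius norm, so the trace may be taken
  termwise.\<close>

lemma mat_power_series_trace:
  fixes T :: "complex^'n^'n"
  assumes "\<forall>z\<in>eball 0 R. summable (\<lambda>k. \<alpha> k * z ^ k)" "ereal (norm T) < R"
  shows "summable (\<lambda>k. cmod (\<alpha> k) * cmod (trace (mat_pow T k)))"
    "(\<lambda>k. \<alpha> k * trace (mat_pow T k)) sums trace (mat_power_series \<alpha> T)"
proof -
  have tr: "trace (mat c ** X) = c * trace X" for c and X :: "complex^'n^'n"
    by (simp add: trace_def scalar_matrix_mult_nth sum_distrib_left)
  have nm: "norm (mat c ** X) = cmod c * norm X" for c and X :: "complex^'n^'n"
    by (simp add: norm_vec_def scalar_matrix_mult_nth norm_mult L2_set_right_distrib)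
  have "summable (\<lambda>k. cmod (\<alpha> k) * norm T ^ k)"
    using summable_norm_power_series[OF assms] by simp
  then have "summable (\<lambda>k. norm (mat 1 :: complex^'n^'n) * (cmod (\<alpha> k) * norm T ^ k))"
    by (rule summable_mult)
  then have sn: "summable (\<lambda>k. norm (mat (\<alpha> k) ** mat_pow T k))"
  proof (rule summable_comparison_test')
    show "norm (norm (mat (\<alpha> k) ** mat_pow T k))
        \<le> norm (mat 1 :: complex^'n^'n) * (cmod (\<alpha> k) * norm T ^ k)" for k
      using mult_left_mono[OF norm_mat_pow_le[of T k], of "cmod (\<alpha> k)"] by (simp add: nm mult_ac)
  qed
  have tn: "cmod (trace X) \<le> norm X * norm (mat 1 :: complex^'n^'n)" for X :: "complex^'n^'n"
    using cmod_trace_mult_le[of X "mat 1"] by simp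
  show "summable (\<lambda>k. cmod (\<alpha> k) * cmod (trace (mat_pow T k)))"
  proof (rule summable_comparison_test'[OF summable_mult2[OF sn, of "norm (mat 1 :: complex^'n^'n)"]])
    show "norm (cmod (\<alpha> k) * cmod (trace (mat_pow T k)))
        \<le> norm (mat (\<alpha> k) ** mat_pow T k) * norm (mat 1 :: complex^'n^'n)" for k
      using tn[of "mat (\<alpha> k) ** mat_pow T k"] by (simp add: tr norm_mult)
  qed
  have "(\<lambda>k. mat (\<alpha> k) ** mat_pow T k) sums mat_power_series \<alpha> T"
    unfolding mat_power_series_def by (intro summable_sums summable_norm_cancel[OF sn])
  from bounded_linear.sums[OF bounded_linear_trace this]
  show "(\<lambda>k. \<alpha> k * trace (mat_pow T k)) sums trace (mat_power_series \<alpha> T)"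
    by (simp add: tr)
qed

text \<open>Absolute convergence inside the disk passes the convergence hypothesis from
  \<open>\<alpha>\<close> on to \<open>abs_coeffs \<alpha>\<close>.\<close>

lemma re_trace_mat_power_series_abs:
  fixes T :: "complex^'n^'n"
  assumes "\<forall>z\<in>eball 0 R. summable (\<lambda>k. \<alpha> k * z ^ k)" "ereal (norm T) < R"
  shows "(\<lambda>k. cmod (\<alpha> k) * re_trace (mat_pow T k)) sums
    re_trace (mat_power_series (abs_coeffs \<alpha>) T)"
proof -
  have "summable (\<lambda>k. abs_coeffs \<alpha> k * z ^ k)" if "z \<in> eball 0 R" for z :: complex
    using summable_norm_power_series[OF assms(1), of "cmod z"] that
    by (intro summable_norm_cancel[of "\<lambda>k. abs_coeffs \<alpha> k * z ^ k"])
      (simp add: abs_coeffs_def norm_mult norm_power)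
  then have "(\<lambda>k. abs_coeffs \<alpha> k * trace (mat_pow T k)) sums trace (mat_power_series (abs_coeffs \<alpha>) T)"
    by (intro mat_power_series_trace(2)[OF _ assms(2)] ballI)
  from bounded_linear.sums[OF bounded_linear_Re this]
  show ?thesis by (simp add: abs_coeffs_def re_trace_def)
qed

text \<open>Triangle inequality, then termwise comparison. The product of traces bounds the norms of
  both matrix arguments and is symmetric, so the lemma also serves with \<open>A\<close> and
  \<open>B\<close> exchanged.\<close>

lemma cmod_trace_series_le_op_norm:
  fixes A B :: "complex^'n^'n"
  assumes conv: "\<forall>z\<in>eball 0 R. summable (\<lambda>k. \<alpha> k * z ^ k)"
    and psd: "pos_semidef A" "pos_semidef B"
    and small: "ereal (re_trace A * re_trace B) < R"
  shows "cmod (trace (mat_power_series \<alpha> (A ** B)))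
    \<le> re_trace (mat_power_series (abs_coeffs \<alpha>) (op_norm A *\<^sub>R B))"
proof -
  have op0: "0 \<le> op_norm A"
    unfolding op_norm_def by (rule onorm_pos_le[OF bounded_linear_matrix_vector])
  have AB: "norm A * norm B \<le> re_trace A * re_trace B"
    using norm_le_re_trace[OF psd(1)] norm_le_re_trace[OF psd(2)]
    by (intro mult_mono) (auto intro: order_trans[OF norm_ge_zero])
  have n1: "ereal (norm (A ** B)) < R"
    using norm_matrix_mult_le[of A B] AB small
    by (intro le_less_trans[OF _ small]) simp
  have "op_norm A * norm B \<le> norm A * norm B"
    by (intro mult_right_mono op_norm_le_norm) simp
  then have n2: "ereal (norm (op_norm A *\<^sub>R B)) < R"
    using AB op0 by (intro le_less_trans[OF _ small]) simp
  note s1 = mat_power_series_trace[OF conv n1] and s2 = re_trace_mat_power_series_abs[OF conv n2]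
  have "cmod (trace (mat_power_series \<alpha> (A ** B)))
      \<le> (\<Sum>k. cmod (\<alpha> k) * cmod (trace (mat_pow (A ** B) k)))"
    using s1 summable_norm[of "\<lambda>k. \<alpha> k * trace (mat_pow (A ** B) k)"]
    by (simp add: norm_mult sums_unique[symmetric])
  also have "\<dots> \<le> (\<Sum>k. cmod (\<alpha> k) * re_trace (mat_pow (op_norm A *\<^sub>R B) k))"
    by (intro suminf_le mult_left_mono cmod_trace_mat_pow_mult_le psd s1(1) sums_summable[OF s2]) simp
  also have "\<dots> = re_trace (mat_power_series (abs_coeffs \<alpha>) (op_norm A *\<^sub>R B))"
    by (rule sums_unique[OF s2, symmetric])
  finally show ?thesis .
qed

text \<open>The exchanged estimate concerns \<open>B ** A\<close>; this brings it back to
  \<open>A ** B\<close>.\<close>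

lemma trace_mat_power_series_commute:
  fixes A B :: "complex^'n^'n"
  assumes "\<forall>z\<in>eball 0 R. summable (\<lambda>k. \<alpha> k * z ^ k)"
    "ereal (norm (A ** B)) < R" "ereal (norm (B ** A)) < R"
  shows "trace (mat_power_series \<alpha> (A ** B)) = trace (mat_power_series \<alpha> (B ** A))"
  using mat_power_series_trace(2)[OF assms(1,2)] mat_power_series_trace(2)[OF assms(1,3)]
  by (simp add: trace_mat_pow_commute[of A B] sums_unique2)

lemma cmod_trace_series_squared_le:
  fixes A B :: "complex^'n^'n"
  assumes conv: "\<forall>z\<in>eball 0 R. summable (\<lambda>k. \<alpha> k * z ^ k)"
    and herm: "conj_transpose A = A" "conj_transpose B = B"
    and small: "ereal (re_trace (A ** A)) < R" "ereal (re_trace (B ** B)) < R"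
  shows "(cmod (trace (mat_power_series \<alpha> (A ** B))))\<^sup>2
    \<le> re_trace (mat_power_series (abs_coeffs \<alpha>) (A ** A))
      * re_trace (mat_power_series (abs_coeffs \<alpha>) (B ** B))"
proof -
  have sq: "re_trace (X ** X) = (norm X)\<^sup>2" if "conj_transpose X = X" for X :: "complex^'n^'n"
    using trace_mult_conj_transpose[of X] by (simp add: that re_trace_def)
  have nA: "ereal (norm (A ** A)) < R" and nB: "ereal (norm (B ** B)) < R"
    using norm_matrix_mult_le[of A A] norm_matrix_mult_le[of B B] small
    by (auto simp: sq herm power2_eq_square intro: le_less_trans[of _ "ereal (norm A * norm A)"]
        le_less_trans[of _ "ereal (norm B * norm B)"])
  \<comment> \<open>A product of two norms is at most the larger square, so the hypotheses on both
    squares also place \<open>A ** B\<close> in the region of convergence.\<close>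
  have "norm (A ** B) \<le> max ((norm A)\<^sup>2) ((norm B)\<^sup>2)"
  proof -
    have "norm A * norm B \<le> max ((norm A)\<^sup>2) ((norm B)\<^sup>2)"
      using mult_right_mono[of "norm A" "norm B" "norm B"] mult_left_mono[of "norm B" "norm A" "norm A"]
      by (cases "norm A \<le> norm B") (auto simp: power2_eq_square)
    then show ?thesis using norm_matrix_mult_le[of A B] by linarith
  qed
  then have nAB: "ereal (norm (A ** B)) < R"
    using small by (auto simp: sq herm max_def split: if_splits intro: le_less_trans[rotated])
  note sAB = mat_power_series_trace(2)[OF conv nAB]
  note sA = re_trace_mat_power_series_abs[OF conv nA] and sB = re_trace_mat_power_series_abs[OF conv nB]
  have pos: "0 \<le> re_trace (mat_pow (X ** X) k)" if "conj_transpose X = X"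
    for k and X :: "complex^'n^'n"
    by (simp add: mat_pow_double re_trace_def trace_mat_pow_even that)
  \<comment> \<open>Finite Cauchy-Schwarz with the weight |\<alpha>_k| split evenly between the two
    factors; the partial sums of nonnegative terms are then bounded by the full series.\<close>
  have partial: "(cmod (\<Sum>k<n. \<alpha> k * trace (mat_pow (A ** B) k)))\<^sup>2
      \<le> re_trace (mat_power_series (abs_coeffs \<alpha>) (A ** A))
        * re_trace (mat_power_series (abs_coeffs \<alpha>) (B ** B))" for n
  proof -
    define x y where "x k = cmod (\<alpha> k) * re_trace (mat_pow (A ** A) k)"
      and "y k = cmod (\<alpha> k) * re_trace (mat_pow (B ** B) k)" for k
    have xy: "0 \<le> x k" "0 \<le> y k" for k
      by (simp_all add: x_def y_def pos herm)
    have "cmod (\<alpha> k * trace (mat_pow (A ** B) k)) \<le> sqrt (x k) * sqrt (y k)" for k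
    proof -
      have "(cmod (\<alpha> k * trace (mat_pow (A ** B) k)))\<^sup>2 \<le> x k * y k"
        using mult_left_mono[OF trace_mat_pow_mult_le[OF herm, of k], of "(cmod (\<alpha> k))\<^sup>2"]
        by (simp add: x_def y_def mat_pow_double norm_mult power_mult_distrib power2_eq_square mult_ac)
      then show ?thesis
        by (simp add: real_le_rsqrt flip: real_sqrt_mult)
    qed
    then have "cmod (\<Sum>k<n. \<alpha> k * trace (mat_pow (A ** B) k)) \<le> (\<Sum>k<n. sqrt (x k) * sqrt (y k))"
      by (intro order_trans[OF norm_sum] sum_mono)
    then have "(cmod (\<Sum>k<n. \<alpha> k * trace (mat_pow (A ** B) k)))\<^sup>2 \<le> (\<Sum>k<n. sqrt (x k) * sqrt (y k))\<^sup>2"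
      by (intro power_mono) auto
    also have "\<dots> \<le> (\<Sum>k<n. (sqrt (x k))\<^sup>2) * (\<Sum>k<n. (sqrt (y k))\<^sup>2)"
      by (rule Cauchy_Schwarz_ineq_sum)
    also have "\<dots> = (\<Sum>k<n. x k) * (\<Sum>k<n. y k)"
      by (simp add: xy)
    also have "\<dots> \<le> suminf x * suminf y"
      using sA sB xy unfolding x_def[symmetric] y_def[symmetric]
      by (intro mult_mono sum_le_suminf suminf_nonneg sum_nonneg) (auto simp: sums_iff)
    also have "\<dots> = re_trace (mat_power_series (abs_coeffs \<alpha>) (A ** A))
        * re_trace (mat_power_series (abs_coeffs \<alpha>) (B ** B))"
      using sA sB unfolding x_def y_def by (simp add: sums_iff)
    finally show ?thesis .
  qed
  have "(\<lambda>n. (cmod (\<Sum>k<n. \<alpha> k * trace (mat_pow (A ** B) k)))\<^sup>2)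
      \<longlonglongrightarrow> (cmod (trace (mat_power_series \<alpha> (A ** B))))\<^sup>2"
    using sAB unfolding sums_def by (intro tendsto_intros)
  then show ?thesis
    by (rule LIMSEQ_le_const2) (use partial in blast)
qed

theorem proposition5:
  fixes \<alpha> :: "nat \<Rightarrow> complex" and R :: ereal and A B :: "complex^'n^'n"
  assumes "R > 0"
    and "\<forall>z\<in>eball 0 R. summable (\<lambda>k. \<alpha> k * z ^ k)"
    and "pos_semidef A" and "pos_semidef B"
  shows "(ereal (re_trace (A ** A)) < R \<and> ereal (re_trace (B ** B)) < R \<longrightarrow>
      (cmod (trace (mat_power_series \<alpha> (A ** B))))\<^sup>2
        \<le> re_trace (mat_power_series (abs_coeffs \<alpha>) (A ** A))
          * re_trace (mat_power_series (abs_coeffs \<alpha>) (B ** B)))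
    \<and> (ereal (re_trace A) < ereal_sqrt R \<and> ereal (re_trace B) < ereal_sqrt R \<longrightarrow>
      cmod (trace (mat_power_series \<alpha> (A ** B)))
        \<le> min (re_trace (mat_power_series (abs_coeffs \<alpha>) (op_norm A *\<^sub>R B)))
               (re_trace (mat_power_series (abs_coeffs \<alpha>) (op_norm B *\<^sub>R A))))"
proof (intro conjI impI)
  assume "ereal (re_trace (A ** A)) < R \<and> ereal (re_trace (B ** B)) < R"
  then show "(cmod (trace (mat_power_series \<alpha> (A ** B))))\<^sup>2
        \<le> re_trace (mat_power_series (abs_coeffs \<alpha>) (A ** A))
          * re_trace (mat_power_series (abs_coeffs \<alpha>) (B ** B))"
    using assms by (intro cmod_trace_series_squared_le[OF assms(2)]) (auto simp: pos_semidefD)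
next
  assume small: "ereal (re_trace A) < ereal_sqrt R \<and> ereal (re_trace B) < ereal_sqrt R"
  have nA: "norm A \<le> re_trace A" and nB: "norm B \<le> re_trace B"
    using assms by (simp_all add: norm_le_re_trace)
  then have tr0: "0 \<le> re_trace A" "0 \<le> re_trace B"
    using norm_ge_zero order_trans by blast+
  \<comment> \<open>For finite \<open>R\<close> two nonnegative factors below its square root
    multiply to less than \<open>R\<close>; for infinite \<open>R\<close> any real product is below
    it.\<close>
  have prod: "ereal (re_trace A * re_trace B) < R"
  proof (cases R)
    case (real r)
    with small have "re_trace A < sqrt r" "re_trace B < sqrt r"
      by (simp_all add: ereal_sqrt_def)
    with tr0 have "re_trace A * re_trace B < sqrt r * sqrt r"
      by (intro mult_strict_mono') auto
    with real assms(1) show ?thesis by simp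
  qed (use assms(1) in auto)
  have AB: "norm A * norm B \<le> re_trace A * re_trace B"
    using nA nB tr0 by (intro mult_mono) auto
  have "ereal (norm (A ** B)) < R" "ereal (norm (B ** A)) < R"
    using norm_matrix_mult_le[of A B] norm_matrix_mult_le[of B A] AB
    by (auto simp: mult.commute intro!: le_less_trans[OF _ prod])
  then have "trace (mat_power_series \<alpha> (A ** B)) = trace (mat_power_series \<alpha> (B ** A))"
    by (rule trace_mat_power_series_commute[OF assms(2)])
  then show "cmod (trace (mat_power_series \<alpha> (A ** B)))
        \<le> min (re_trace (mat_power_series (abs_coeffs \<alpha>) (op_norm A *\<^sub>R B)))
               (re_trace (mat_power_series (abs_coeffs \<alpha>) (op_norm B *\<^sub>R A)))"
    using cmod_trace_series_le_op_norm[OF assms(2,3,4) prod]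
      cmod_trace_series_le_op_norm[OF assms(2,4,3)] prod by (simp add: mult.commute)
qed

end
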